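(* Consider the Energy Sharing Game $(N,v)$ with admission fees $c_i\ge 0$, $i\in U$, let $\varepsilon^*$ be its least core value, and let $M_a=\max\{x_a:x\in C_{\varepsilon^*}(N,v)\}$ and $m_a=\min\{x_a:x\in C_{\varepsilon^*}(N,v)\}$ be the maximum and minimum shares of the aggregator in the least core. Let $x^*=(\varepsilon^*,\dots,\varepsilon^* )\in\mathbb{R}^{|U|}$. Let $$\mathcal{R}=\arg\min\Big\{\frac{v(N)-v(S)}{|N|-|S\cap U|}:S\in\mathcal{P}^a\Big\},\qquad S_{\min}=\bigcap_{S\in\mathcal{R}}S.$$ Suppose $C(N,v)\ne\emptyset$. Then the following statements are equivalent: (i) $m_a=M_a$; (ii) the optimal solution of the linear program $(P_U^* )$ is $x^*$; (iii) $C_{\varepsilon^*}(N,v)=\{(x^*,M_a)\}$; (iv) $S_{\min}=\{a\}$.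
   Context: Energy Sharing Game. The player set is $N=U\cup\{a\}$, where $U$ is a finite set of users with $|U|\ge 2$ and $a\notin U$ is the aggregator. Fix an integer $m\ge 1$. Each user $i\in U$ has: a compact set $D_i\subseteq\mathbb{R}^{n_i}\times\mathbb{R}^{2m}_+$, whose points are written $(z_i,y_i)$ with $y_i=[y_i^+,y_i^-]\in\mathbb{R}^m_+\times\mathbb{R}^m_+$, such that $D_i^z=\{z_i\in\mathbb{R}^{n_i}:(z_i,0)\in D_i\}$ is nonempty; a continuous function $f_i:\mathbb{R}^{n_i+2m}\to\mathbb{R}$; and an admission fee $c_i\ge 0$. There is also a continuous function $f_a:\mathbb{R}^m\to\mathbb{R}_+$ with $f_a(0)=0$. Put $b_i=\max\{f_i(z_i,0):z_i\in D_i^z\}$ and, for $S\subseteq N$ with $a\in S$ and $|S\cap U|\ge 2$, $$b_S=\max\Big\{\sum_{i\in S\cap U} [f_i(z_i,y_i)-c_i]+f_a\Big(\sum_{i\in S\cap U}y_i^+\Big):\ (z_i,y_i)\in D_i\ (i\in S\cap U),\ \sum_{i\in S\cap U}y_i^+=\sum_{i\in S\cap U}y_i^-\Big\}.$$ The characteristic function is $v(S)=b_S-\sum_{i\in S\cap U}b_i$ if $a\in S$ and $|S\cap U|\ge 2$, and $v(S)=0$ for every other $S\subseteq N$. Notation: $\mathcal{P}=\{S\subseteq N:S\ne\emptyset,S\ne N\}$, $\mathcal{P}^a=\{S\in\mathcal{P}:a\in S\}$, $\mathcal{P}^{-a}=\mathcal{P}\setminus\mathcal{P}^a$. An allocation is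 a vector in $\mathbb{R}^{|N|}$, ordered with the aggregator's component last; $x(S)=\sum_{i\in S}x_i$. The strong $\varepsilon$-core is $C_\varepsilon(N,v)=\{x\in\mathbb{R}^{|N|}:x(N)=v(N),\ x(S)\ge v(S)+\varepsilon\ \forall S\in\mathcal{P}\}$; the core is $C(N,v)=C_0(N,v)$. The least core value $\varepsilon^*$ is the largest $\varepsilon\in\mathbb{R}$ with $C_\varepsilon(N,v)\ne\emptyset$, and $C_{\varepsilon^*}(N,v)$ is the least core. The linear program $(P_U^* )$, in the variable $x\in\mathbb{R}^{|U|}$, is: maximize $x(U)$ subject to $x(S)\ge\varepsilon^*$ for all $S\in\mathcal{P}^{-a}$ and $x(N\setminus S)\le v(N)-v(S)-\varepsilon^*$ for all $S\in\mathcal{P}^a$. *)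

theory Defs
  imports "HOL-Analysis.Analysis"
begin

text \<open>Transferable utility games. A game is a player set \<open>N\<close> with a function \<open>v\<close> on coalitions;
  an allocation (a vector indexed by \<open>N\<close>) is an element of \<open>N \<rightarrow>\<^sub>E UNIV\<close>.\<close>

definition proper_coalitions :: "'p set \<Rightarrow> 'p set set" where
  "proper_coalitions N = {S. S \<subseteq> N \<and> S \<noteq> {} \<and> S \<noteq> N}"

definition coalitions_with :: "'p set \<Rightarrow> 'p \<Rightarrow> 'p set set" where
  "coalitions_with N a = {S \<in> proper_coalitions N. a \<in> S}"

definition coalitions_without :: "'p set \<Rightarrow> 'p \<Rightarrow> 'p set set" where
  "coalitions_without N a = proper_coalitions N - coalitions_with N a"

definition strong_core :: "real \<Rightarrow> 'p set \<Rightarrow> ('p set \<Rightarrow> real) \<Rightarrow> ('p \<Rightarrow> real) set" where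
  "strong_core \<epsilon> N v =
     {x \<in> N \<rightarrow>\<^sub>E UNIV. sum x N = v N \<and> (\<forall>S\<in>proper_coalitions N. sum x S \<ge> v S + \<epsilon>)}"

definition core :: "'p set \<Rightarrow> ('p set \<Rightarrow> real) \<Rightarrow> ('p \<Rightarrow> real) set" where
  "core N v = strong_core 0 N v"

definition least_core_value :: "'p set \<Rightarrow> ('p set \<Rightarrow> real) \<Rightarrow> real" where
  "least_core_value N v = (GREATEST \<epsilon>. strong_core \<epsilon> N v \<noteq> {})"

definition least_core :: "'p set \<Rightarrow> ('p set \<Rightarrow> real) \<Rightarrow> ('p \<Rightarrow> real) set" where
  "least_core N v = strong_core (least_core_value N v) N v"

definition max_share :: "'p set \<Rightarrow> ('p set \<Rightarrow> real) \<Rightarrow> 'p \<Rightarrow> real" where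
  "max_share N v i = (GREATEST t. \<exists>x\<in>least_core N v. t = x i)"

definition min_share :: "'p set \<Rightarrow> ('p set \<Rightarrow> real) \<Rightarrow> 'p \<Rightarrow> real" where
  "min_share N v i = (LEAST t. \<exists>x\<in>least_core N v. t = x i)"


text \<open>The dimension \<open>n\<close> differs from user to user, so the space of real \<open>n\<close>-vectors is taken to be
  the set of sequences vanishing from index \<open>n\<close> on. The topology that it inherits from the product
  topology on \<open>nat \<Rightarrow> real\<close> is the Euclidean one.\<close>

definition Rspace :: "nat \<Rightarrow> (nat \<Rightarrow> real) set" where
  "Rspace n = {z. \<forall>k\<ge>n. z k = 0}"

text \<open>A point \<open>(z, yp, ym)\<close> collects the vector \<open>z\<close> and the two halves of \<open>y\<close>; the
  number \<open>m \<ge> 1\<close> is \<open>CARD('m)\<close>.\<close>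

type_synonym 'm point = "(nat \<Rightarrow> real) \<times> (real ^ 'm) \<times> (real ^ 'm)"

abbreviation ypos :: "'m point \<Rightarrow> real ^ 'm" where "ypos w \<equiv> fst (snd w)"
abbreviation yneg :: "'m point \<Rightarrow> real ^ 'm" where "yneg w \<equiv> snd (snd w)"

locale energy_sharing_game =
  fixes U :: "'p set"
    and a :: 'p
    and n :: "'p \<Rightarrow> nat"
    and D :: "'p \<Rightarrow> ('m::finite) point set"
    and f :: "'p \<Rightarrow> 'm point \<Rightarrow> real"
    and c :: "'p \<Rightarrow> real"
    and fa :: "real ^ 'm \<Rightarrow> real"
  assumes finite_users: "finite U"
    and two_users: "card U \<ge> 2"
    and aggregator_not_user: "a \<notin> U"
    and D_space: "i \<in> U \<Longrightarrow>
      D i \<subseteq> Rspace (n i) \<times> {yp. \<forall>k. yp $ k \<ge> 0} \<times> {ym. \<forall>k. ym $ k \<ge> 0}"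
    and D_compact: "i \<in> U \<Longrightarrow> compact (D i)"
    and D_no_exchange_nonempty: "i \<in> U \<Longrightarrow> {z. (z, 0, 0) \<in> D i} \<noteq> {}"
    and f_continuous: "i \<in> U \<Longrightarrow> continuous_on (Rspace (n i) \<times> UNIV) (f i)"
    and fee_nonneg: "i \<in> U \<Longrightarrow> c i \<ge> 0"
    and fa_continuous: "continuous_on UNIV fa"
    and fa_nonneg: "fa y \<ge> 0"
    and fa_zero: "fa 0 = 0"

definition standalone_benefit ::
  "('p \<Rightarrow> ('m::finite) point set) \<Rightarrow> ('p \<Rightarrow> 'm point \<Rightarrow> real) \<Rightarrow> 'p \<Rightarrow> real" where
  "standalone_benefit D f i = (GREATEST t. \<exists>z. (z, 0, 0) \<in> D i \<and> t = f i (z, 0, 0))"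

definition joint_benefit ::
  "'p set \<Rightarrow> ('p \<Rightarrow> ('m::finite) point set) \<Rightarrow> ('p \<Rightarrow> 'm point \<Rightarrow> real) \<Rightarrow> ('p \<Rightarrow> real) \<Rightarrow>
   (real ^ 'm \<Rightarrow> real) \<Rightarrow> 'p set \<Rightarrow> real" where
  "joint_benefit U D f c fa S =
     (GREATEST t. \<exists>w. (\<forall>i\<in>S \<inter> U. w i \<in> D i) \<and>
        (\<Sum>i\<in>S \<inter> U. ypos (w i)) = (\<Sum>i\<in>S \<inter> U. yneg (w i)) \<and>
        t = (\<Sum>i\<in>S \<inter> U. f i (w i) - c i) + fa (\<Sum>i\<in>S \<inter> U. ypos (w i)))"

definition energy_sharing_value ::
  "'p set \<Rightarrow> 'p \<Rightarrow> ('p \<Rightarrow> ('m::finite) point set) \<Rightarrow> ('p \<Rightarrow> 'm point \<Rightarrow> real) \<Rightarrow> ('p \<Rightarrow> real) \<Rightarrow>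
   (real ^ 'm \<Rightarrow> real) \<Rightarrow> 'p set \<Rightarrow> real" where
  "energy_sharing_value U a D f c fa S =
     (if a \<in> S \<and> card (S \<inter> U) \<ge> 2
      then joint_benefit U D f c fa S - (\<Sum>i\<in>S \<inter> U. standalone_benefit D f i)
      else 0)"


definition user_lp_feasible :: "'p set \<Rightarrow> 'p \<Rightarrow> ('p set \<Rightarrow> real) \<Rightarrow> ('p \<Rightarrow> real) set" where
  "user_lp_feasible U a v =
     (let N = insert a U; \<epsilon> = least_core_value N v in
      {x \<in> U \<rightarrow>\<^sub>E UNIV.
         (\<forall>S\<in>coalitions_without N a. sum x S \<ge> \<epsilon>) \<and>
         (\<forall>S\<in>coalitions_with N a. sum x (N - S) \<le> v N - v S - \<epsilon>)})"

definition user_lp_solutions :: "'p set \<Rightarrow> 'p \<Rightarrow> ('p set \<Rightarrow> real) \<Rightarrow> ('p \<Rightarrow> real) set" where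
  "user_lp_solutions U a v =
     {x. is_arg_max (\<lambda>x. sum x U) (\<lambda>x. x \<in> user_lp_feasible U a v) x}"

definition min_ratio_coalitions :: "'p set \<Rightarrow> 'p \<Rightarrow> ('p set \<Rightarrow> real) \<Rightarrow> 'p set set" where
  "min_ratio_coalitions U a v =
     (let N = insert a U in
      {S. is_arg_min (\<lambda>S. (v N - v S) / (real (card N) - real (card (S \<inter> U))))
            (\<lambda>S. S \<in> coalitions_with N a) S})"

end

theory Submission
  imports Defs
begin

text \<open>
  Coalitions without the aggregator are worth nothing. So, for \<open>\<epsilon> \<ge> 0\<close>, an allocation lies in the
  strong \<open>\<epsilon>\<close>-core as soon as each user gets at least \<open>\<epsilon>\<close> and
  \<open>x(N - S) \<le> v(N) - v(S) - \<epsilon>\<close> for every proper \<open>S\<close> containing the aggregator. Giving every user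
  exactly \<open>\<epsilon>\<close> is the most favourable choice for the latter constraints, whence \<open>\<epsilon>*\<close> is the minimal
  ratio defining \<open>\<R>\<close>, and \<open>x*\<close> is the least point of the feasible set of \<open>(P\<^sub>U*)\<close>. The least core is a
  copy of this feasible set, and each of the four statements says that \<open>x*\<close> is its only point. For (iv):
  the coalitions in \<open>\<R>\<close> are those whose constraint is tight at \<open>x*\<close>; a tight constraint pins
  the users outside \<open>S\<close> to \<open>\<epsilon>*\<close>, whereas the share of a user belonging to all of \<open>\<R>\<close>
  can be raised slightly.
\<close>

text \<open>An extensional function is pinned to \<open>undefined\<close> off \<open>I\<close>, so
  the box is a product over the whole index type with singleton factors off \<open>I\<close>, and
  Tychonoff applies.\<close>

lemma compact_PiE_box:
  fixes l u :: real
  shows "compact (I \<rightarrow>\<^sub>E {l..u})"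
proof -
  have "I \<rightarrow>\<^sub>E {l..u} = (\<Pi>\<^sub>E i\<in>UNIV. if i \<in> I then {l..u} else {undefined})"
    by (auto simp: PiE_def Pi_def extensional_def split: if_splits)
  moreover have "compactin (product_topology (\<lambda>i. euclidean) UNIV)
      (\<Pi>\<^sub>E i\<in>UNIV. if i \<in> I then {l..u} else {undefined})"
    by (simp add: compactin_PiE)
  ultimately show ?thesis
    by (simp add: euclidean_product_topology)
qed

lemma continuous_on_sum_coordinates:
  "continuous_on A (\<lambda>x::'i \<Rightarrow> real. sum x I)"
  by (intro continuous_on_sum continuous_on_subset [OF continuous_on_product_coordinates]) auto

text \<open>The abstract setting of the argument: the aggregator is a veto player and the core is
  nonempty.\<close>

locale veto_game =
  fixes U :: "'p set" and a :: 'p and v :: "'p set \<Rightarrow> real"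
  assumes finite_U: "finite U"
    and U_nonempty: "U \<noteq> {}"
    and a_notin: "a \<notin> U"
    and veto: "S \<subseteq> U \<Longrightarrow> v S = 0"
    and core_nonempty: "core (insert a U) v \<noteq> {}"
begin

abbreviation N :: "'p set" where "N \<equiv> insert a U"

abbreviation P :: "'p set set" where "P \<equiv> coalitions_with N a"

definition ratio :: "'p set \<Rightarrow> real" where
  "ratio S = (v N - v S) / (real (card N) - real (card (S \<inter> U)))"

abbreviation eps :: real where "eps \<equiv> least_core_value N v"

section \<open>Coalitions and ratios\<close>

lemma P_iff: "S \<in> P \<longleftrightarrow> a \<in> S \<and> S \<subset> N"
  by (auto simp: coalitions_with_def proper_coalitions_def)

lemma without_iff: "S \<in> coalitions_without N a \<longleftrightarrow> S \<noteq> {} \<and> S \<subseteq> U"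
  using a_notin by (auto simp: coalitions_without_def coalitions_with_def proper_coalitions_def)

lemma proper_cases: "S \<in> proper_coalitions N \<longleftrightarrow> S \<in> P \<or> S \<in> coalitions_without N a"
  by (auto simp: coalitions_without_def coalitions_with_def)

lemma finite_P: "finite P"
proof (rule finite_subset)
  show "P \<subseteq> Pow N" by (auto simp: P_iff)
qed (simp add: finite_U)

lemma singleton_in_P: "{a} \<in> P"
  using U_nonempty a_notin by (auto simp: P_iff)

lemma complement_subset: "S \<in> P \<Longrightarrow> N - S \<subseteq> U"
  by (auto simp: P_iff)

lemma card_complement: "S \<in> P \<Longrightarrow> real (card N) - real (card (S \<inter> U)) = real (card (N - S)) + 1"
proof -
  assume S: "S \<in> P"
  have "N - S = U - (S \<inter> U)" using S by (auto simp: P_iff)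
  then have "card (N - S) = card U - card (S \<inter> U)"
    using finite_U by (simp add: card_Diff_subset)
  moreover have "card (S \<inter> U) \<le> card U" by (simp add: card_mono finite_U)
  ultimately show ?thesis using finite_U a_notin by simp
qed

text \<open>Clearing the positive denominator \<open>card (N - S) + 1\<close> leaves the constraint
  of \<open>S\<close> evaluated where every user gets \<open>e\<close>.\<close>

lemma le_ratio_iff: "S \<in> P \<Longrightarrow> e \<le> ratio S \<longleftrightarrow> real (card (N - S)) * e \<le> v N - v S - e"
  by (simp add: ratio_def card_complement pos_le_divide_eq algebra_simps)

lemma ratio_eq_iff: "S \<in> P \<Longrightarrow> ratio S = e \<longleftrightarrow> real (card (N - S)) * e = v N - v S - e"
  by (auto simp: ratio_def card_complement divide_eq_eq algebra_simps)

text \<open>As \<open>e\<close> is nonnegative, one member already contributes \<open>e\<close> and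
  the others cannot lower the sum. This reduces the constraints of user coalitions to
  singletons.\<close>

lemma sum_ge_if_all_ge:
  fixes e :: real
  assumes "e \<ge> 0" "\<forall>i\<in>U. e \<le> x i" "S \<noteq> {}" "S \<subseteq> U"
  shows "e \<le> sum x S"
proof -
  obtain i where i: "i \<in> S" using assms by blast
  have "finite S" using assms finite_U finite_subset by blast
  moreover have "0 \<le> x j" if "j \<in> S" for j
    using that assms(2,4) by (intro order_trans [OF assms(1)]) auto
  ultimately have "x i \<le> sum x S"
    using i by (intro member_le_sum) auto
  then show ?thesis using assms i by force
qed

text \<open>Efficiency turns the lower bound on \<open>S\<close> into an upper bound on its
  complement, which consists of users only.\<close>

lemma strong_core_iff:
  assumes "e \<ge> 0"
  shows "x \<in> strong_core e N v \<longleftrightarrow> x \<in> N \<rightarrow>\<^sub>E UNIV \<and> x a = v N - sum x U \<and>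
    (\<forall>i\<in>U. e \<le> x i) \<and> (\<forall>S\<in>P. sum x (N - S) \<le> v N - v S - e)"
proof -
  have compl: "(v S + e \<le> sum x S) = (sum x (N - S) \<le> v N - v S - e)"
    if "S \<in> P" "sum x N = v N" for S
  proof -
    have "sum x (N - S) = sum x N - sum x S"
      using that finite_U by (intro sum_diff) (auto simp: P_iff)
    then show ?thesis using that by auto
  qed
  have "(\<forall>S\<in>coalitions_without N a. v S + e \<le> sum x S) \<longleftrightarrow> (\<forall>i\<in>U. e \<le> x i)"
  proof
    assume L: "\<forall>S\<in>coalitions_without N a. v S + e \<le> sum x S"
    show "\<forall>i\<in>U. e \<le> x i"
    proof
      fix i assume "i \<in> U"
      then show "e \<le> x i"
        using L[rule_format, of "{i}"] veto[of "{i}"] by (auto simp: without_iff)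
    qed
  next
    assume "\<forall>i\<in>U. e \<le> x i"
    then show "\<forall>S\<in>coalitions_without N a. v S + e \<le> sum x S"
      using sum_ge_if_all_ge[OF assms] veto by (auto simp: without_iff)
  qed
  moreover have "sum x N = x a + sum x U"
    using finite_U a_notin by simp
  ultimately show ?thesis
    using compl by (auto simp: strong_core_def proper_cases)
qed

section \<open>The least core value as a minimal ratio\<close>

lemma ratio_ge_of_strong_core:
  assumes "e \<ge> 0" "x \<in> strong_core e N v" "S \<in> P"
  shows "e \<le> ratio S"
proof -
  have "real (card (N - S)) * e \<le> sum x (N - S)"
    using assms complement_subset strong_core_iff by (intro sum_bounded_below) blast
  then show ?thesis
    using assms strong_core_iff le_ratio_iff by fastforce
qed

lemma least_core_value_eq: "eps = Min (ratio ` P)"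
  and least_core_value_nonneg: "eps \<ge> 0"
proof -
  let ?r = "Min (ratio ` P)"
  \<comment> \<open>A core allocation makes all ratios nonnegative, so
    \<open>strong_core_iff\<close> becomes available at \<open>?r\<close>.\<close>
  obtain x0 where "x0 \<in> strong_core 0 N v"
    using core_nonempty by (auto simp: core_def)
  then have r0: "?r \<ge> 0"
    using finite_P singleton_in_P ratio_ge_of_strong_core[of 0] by (subst Min_ge_iff) auto
  \<comment> \<open>Each user gets the minimal ratio and the aggregator the remainder, which shows
    that the bound is attained.\<close>
  define y where "y = (\<lambda>i\<in>N. if i = a then v N - real (card U) * ?r else ?r)"
  have sum_y: "sum y T = real (card T) * ?r" if "T \<subseteq> U" for T
  proof -
    have "sum y T = sum (\<lambda>_. ?r) T"
      using that a_notin by (intro sum.cong) (auto simp: y_def)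
    then show ?thesis by simp
  qed
  have "real (card (N - S)) * ?r \<le> v N - v S - ?r" if "S \<in> P" for S
    using that finite_P by (subst le_ratio_iff [OF that, symmetric]) simp
  moreover have "y a = v N - sum y U"
    unfolding sum_y [OF order_refl] by (simp add: y_def)
  moreover have "y \<in> N \<rightarrow>\<^sub>E UNIV" "\<forall>i\<in>U. ?r \<le> y i"
    using a_notin by (auto simp: y_def)
  ultimately have "y \<in> strong_core ?r N v"
    unfolding strong_core_iff[OF r0] by (simp add: sum_y complement_subset)
  moreover have "e \<le> ?r" if "strong_core e N v \<noteq> {}" for e
  proof (cases "e \<ge> 0")
    case True
    then show ?thesis
      using that finite_P singleton_in_P ratio_ge_of_strong_core by (subst Min_ge_iff) auto
  qed (use r0 in linarith)
  ultimately show "eps = ?r"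
    unfolding least_core_value_def by (intro Greatest_equality) auto
  then show "eps \<ge> 0" using r0 by simp
qed

lemma eps_le_ratio: "S \<in> P \<Longrightarrow> eps \<le> ratio S"
  by (simp add: least_core_value_eq finite_P)

lemma min_ratio_coalitions_iff:
  "S \<in> min_ratio_coalitions U a v \<longleftrightarrow> S \<in> P \<and> ratio S = eps"
proof -
  have "eps \<in> ratio ` P"
    unfolding least_core_value_eq using finite_P singleton_in_P by (intro Min_in) auto
  then obtain T where T: "T \<in> P" "ratio T = eps" by auto
  have "S \<in> min_ratio_coalitions U a v \<longleftrightarrow> is_arg_min ratio (\<lambda>S. S \<in> P) S"
    by (simp add: min_ratio_coalitions_def ratio_def [abs_def] Let_def)
  also have "\<dots> \<longleftrightarrow> S \<in> P \<and> (\<forall>T\<in>P. ratio S \<le> ratio T)"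
    by (auto simp: is_arg_min_linorder)
  also have "\<dots> \<longleftrightarrow> S \<in> P \<and> ratio S = eps"
    using T eps_le_ratio [of S] eps_le_ratio by (auto simp flip: T(2) intro: order.antisym)
  finally show ?thesis .
qed

section \<open>The feasible set of the linear program and the least core\<close>

abbreviation F :: "('p \<Rightarrow> real) set" where "F \<equiv> user_lp_feasible U a v"

lemma feasible_iff:
  "x \<in> F \<longleftrightarrow> x \<in> U \<rightarrow>\<^sub>E UNIV \<and> (\<forall>i\<in>U. eps \<le> x i) \<and> (\<forall>S\<in>P. sum x (N - S) \<le> v N - v S - eps)"
proof -
  have "(\<forall>S\<in>coalitions_without N a. eps \<le> sum x S) \<longleftrightarrow> (\<forall>i\<in>U. eps \<le> x i)"
  proof
    assume L: "\<forall>S\<in>coalitions_without N a. eps \<le> sum x S"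
    show "\<forall>i\<in>U. eps \<le> x i"
      using L[rule_format, of "{i}" for i] by (auto simp: without_iff)
  next
    assume "\<forall>i\<in>U. eps \<le> x i"
    then show "\<forall>S\<in>coalitions_without N a. eps \<le> sum x S"
      using sum_ge_if_all_ge[OF least_core_value_nonneg] by (auto simp: without_iff)
  qed
  then show ?thesis by (auto simp: user_lp_feasible_def Let_def)
qed

text \<open>The share of the aggregator is the one forced by efficiency.\<close>

definition extend :: "('p \<Rightarrow> real) \<Rightarrow> 'p \<Rightarrow> real" where
  "extend x = x(a := v N - sum x U)"

lemma extend_aggregator [simp]: "extend x a = v N - sum x U"
  by (simp add: extend_def)

lemma extend_user: "i \<in> U \<Longrightarrow> extend x i = x i"
  using a_notin by (auto simp: extend_def)

lemma sum_extend: "T \<subseteq> U \<Longrightarrow> sum (extend x) T = sum x T"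
  by (intro sum.cong) (auto simp: extend_user)

lemma least_core_eq: "least_core N v = extend ` F"
proof
  show "extend ` F \<subseteq> least_core N v"
  proof
    fix y assume "y \<in> extend ` F"
    then obtain x where x: "x \<in> F" "y = extend x" by auto
    have "extend x \<in> N \<rightarrow>\<^sub>E UNIV"
      using x by (auto simp: feasible_iff extend_def PiE_def extensional_def)
    moreover have "\<forall>i\<in>U. eps \<le> extend x i"
      using x by (simp add: feasible_iff extend_user)
    moreover have "\<forall>S\<in>P. sum (extend x) (N - S) \<le> v N - v S - eps"
      using x by (simp add: feasible_iff sum_extend complement_subset)
    ultimately show "y \<in> least_core N v"
      unfolding least_core_def strong_core_iff[OF least_core_value_nonneg] x(2)
      by (simp add: sum_extend)
  qed
next
  show "least_core N v \<subseteq> extend ` F"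
  proof
    fix y assume y: "y \<in> least_core N v"
    define x where "x = restrict y U"
    have sum_x: "sum x T = sum y T" if "T \<subseteq> U" for T
      using that by (intro sum.cong) (auto simp: x_def)
    have "x \<in> F"
      using y sum_x complement_subset
      unfolding least_core_def strong_core_iff[OF least_core_value_nonneg]
      by (auto simp: feasible_iff x_def)
    moreover have "y = extend x"
    proof
      fix i show "y i = extend x i"
        using y sum_x[of U] unfolding least_core_def strong_core_iff[OF least_core_value_nonneg]
        by (auto simp: extend_def x_def PiE_def extensional_def)
    qed
    ultimately show "y \<in> extend ` F" by blast
  qed
qed

lemma inj_on_extend: "inj_on extend F"
proof
  fix x y assume xy: "x \<in> F" "y \<in> F" "extend x = extend y"
  show "x = y"
  proof (rule PiE_ext)
    show "x \<in> U \<rightarrow>\<^sub>E UNIV" "y \<in> U \<rightarrow>\<^sub>E UNIV" using xy by (auto simp: feasible_iff)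
    show "x i = y i" if "i \<in> U" for i
      using fun_cong[OF xy(3), of i] that a_notin by (auto simp: extend_def split: if_splits)
  qed
qed

definition xs :: "'p \<Rightarrow> real" where "xs = (\<lambda>i\<in>U. eps)"

lemma sum_xs: "T \<subseteq> U \<Longrightarrow> sum xs T = real (card T) * eps"
proof -
  assume "T \<subseteq> U"
  then have "sum xs T = sum (\<lambda>_. eps) T" by (intro sum.cong) (auto simp: xs_def)
  then show ?thesis by simp
qed

text \<open>At \<open>xs\<close> the constraint of \<open>S\<close> says exactly that
  \<open>eps\<close> is at most \<open>ratio S\<close>.\<close>

lemma xs_feasible: "xs \<in> F"
  unfolding feasible_iff
proof (intro conjI ballI)
  fix S assume "S \<in> P"
  then show "sum xs (N - S) \<le> v N - v S - eps"
    using eps_le_ratio le_ratio_iff by (simp only: sum_xs complement_subset)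
qed (auto simp: xs_def)

lemma sum_ge_sum_xs: "x \<in> F \<Longrightarrow> sum xs U \<le> sum x U"
  by (rule sum_mono) (auto simp: feasible_iff xs_def)

text \<open>Since \<open>xs\<close> lies below \<open>x\<close> in every coordinate, equal totals
  force equal coordinates.\<close>

lemma eq_xs_if_sum_le:
  assumes "x \<in> F" "sum x U \<le> sum xs U"
  shows "x = xs"
proof (rule PiE_ext)
  show "x \<in> U \<rightarrow>\<^sub>E UNIV" "xs \<in> U \<rightarrow>\<^sub>E UNIV" using assms xs_feasible by (auto simp: feasible_iff)
  have ge: "xs i \<le> x i" if "i \<in> U" for i
    using assms that by (auto simp: feasible_iff xs_def)
  have "sum xs U = sum x U" using assms sum_ge_sum_xs by (intro order.antisym)
  then show "x i = xs i" if "i \<in> U" for i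
    using sum_mono_inv[of xs U x i] ge that finite_U by simp
qed

text \<open>Guarantees that the minimum share is attained. The upper bound on each coordinate comes
  from the constraint of \<open>{a}\<close>, whose complement is all of \<open>U\<close>.\<close>

lemma compact_feasible: "compact F"
proof -
  define B where "B = v N - v {a} - eps"
  have "x i \<le> B" if "x \<in> F" "i \<in> U" for x i
  proof -
    have "0 \<le> x j" if "j \<in> U" for j
      using that \<open>x \<in> F\<close> by (intro order_trans [OF least_core_value_nonneg]) (simp add: feasible_iff)
    then have "x i \<le> sum x U"
      using that finite_U by (intro member_le_sum) auto
    also have "sum x U = sum x (N - {a})" using a_notin by simp
    also have "\<dots> \<le> B"
      using \<open>x \<in> F\<close> singleton_in_P unfolding feasible_iff B_def by blast
    finally show ?thesis .
  qed
  then have "F = (U \<rightarrow>\<^sub>E {eps..B}) \<inter> (\<Inter>S\<in>P. {x. sum x (N - S) \<le> v N - v S - eps})"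
    by (auto simp: feasible_iff PiE_def Pi_def)
  moreover have "closed (\<Inter>S\<in>P. {x::'p \<Rightarrow> real. sum x (N - S) \<le> v N - v S - eps})"
    by (intro closed_INT ballI closed_Collect_le continuous_on_sum_coordinates continuous_on_const)
  ultimately show ?thesis
    by (simp only: compact_Int_closed compact_PiE_box)
qed

section \<open>The four statements as uniqueness of the feasible point\<close>

lemma max_share_eq: "max_share N v a = v N - sum xs U"
  unfolding max_share_def least_core_eq
  using xs_feasible sum_ge_sum_xs by (intro Greatest_equality) auto

text \<open>The aggregator gets \<open>v N\<close> minus the users' total, so its shares agree
  exactly when the largest feasible total equals the smallest, that of \<open>xs\<close>.\<close>

lemma min_share_eq_max_share_iff: "min_share N v a = max_share N v a \<longleftrightarrow> F = {xs}"
proof -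
  obtain y where y: "y \<in> F" "\<And>x. x \<in> F \<Longrightarrow> sum x U \<le> sum y U"
    using continuous_attains_sup[OF compact_feasible _ continuous_on_sum_coordinates] xs_feasible by blast
  have "min_share N v a = v N - sum y U"
    unfolding min_share_def least_core_eq
    using y by (intro Least_equality) auto
  moreover have "sum y U = sum xs U \<longleftrightarrow> F = {xs}"
  proof
    assume "sum y U = sum xs U"
    then have "x = xs" if "x \<in> F" for x
      using y(2) [OF that] eq_xs_if_sum_le [OF that] by simp
    then show "F = {xs}" using xs_feasible by blast
  qed (use y(1) in simp)
  ultimately show ?thesis by (auto simp: max_share_eq)
qed

lemma user_lp_solutions_iff: "user_lp_solutions U a v = {xs} \<longleftrightarrow> F = {xs}"
proof
  assume "user_lp_solutions U a v = {xs}"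
  then have "xs \<in> user_lp_solutions U a v" by simp
  then have "sum x U \<le> sum xs U" if "x \<in> F" for x
    using that by (simp add: user_lp_solutions_def is_arg_max_linorder)
  then show "F = {xs}"
    using eq_xs_if_sum_le xs_feasible by blast
next
  assume "F = {xs}"
  then show "user_lp_solutions U a v = {xs}"
    by (auto simp: user_lp_solutions_def is_arg_max_linorder)
qed

lemma least_core_singleton_iff: "least_core N v = {extend xs} \<longleftrightarrow> F = {xs}"
proof
  assume "least_core N v = {extend xs}"
  then have "extend ` F = extend ` {xs}" by (simp add: least_core_eq)
  then show "F = {xs}"
    using inj_on_image_eq_iff[OF inj_on_extend, of F "{xs}"] xs_feasible by blast
qed (simp add: least_core_eq)

lemma min_ratio_Inter_iff: "\<Inter> (min_ratio_coalitions U a v) = {a} \<longleftrightarrow> F = {xs}"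
proof
  assume R: "\<Inter> (min_ratio_coalitions U a v) = {a}"
  have "x = xs" if x: "x \<in> F" for x
  proof (rule PiE_ext)
    show "x \<in> U \<rightarrow>\<^sub>E UNIV" "xs \<in> U \<rightarrow>\<^sub>E UNIV" using x xs_feasible by (auto simp: feasible_iff)
    fix i assume i: "i \<in> U"
    then have "i \<notin> \<Inter> (min_ratio_coalitions U a v)" using R a_notin by auto
    then obtain S where S: "S \<in> P" "ratio S = eps" "i \<notin> S"
      by (auto simp: min_ratio_coalitions_iff)
    have le: "xs j \<le> x j" if "j \<in> N - S" for j
      using that x complement_subset[OF S(1)] by (auto simp: feasible_iff xs_def)
    \<comment> \<open>As \<open>ratio S = eps\<close>, the constraint of \<open>S\<close> is tight
      at \<open>xs\<close>.\<close>
    have "sum x (N - S) \<le> sum xs (N - S)"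
      using x S ratio_eq_iff[OF S(1), of eps] sum_xs[OF complement_subset[OF S(1)]]
      by (auto simp: feasible_iff)
    then have "sum xs (N - S) = sum x (N - S)"
      using sum_mono[of "N - S" xs x] le by auto
    then show "x i = xs i"
      using sum_mono_inv[of xs "N - S" x i] le finite_U i S by auto
  qed
  then show "F = {xs}" using xs_feasible by blast
next
  assume F: "F = {xs}"
  have "i \<notin> \<Inter> (min_ratio_coalitions U a v)" if i: "i \<in> U" for i
  proof
    assume R: "i \<in> \<Inter> (min_ratio_coalitions U a v)"
    \<comment> \<open>The slack of the constraint of \<open>S\<close> at \<open>xs\<close>. It is
      positive when \<open>i\<close> is outside \<open>S\<close>, since such an \<open>S\<close>
      does not attain the minimal ratio.\<close>
    define slack where "slack S = v N - v S - eps - real (card (N - S)) * eps" for S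
    define Q where "Q = {S \<in> P. i \<notin> S}"
    have slack: "slack S > 0" if "S \<in> Q" for S
    proof -
      have "S \<in> P" using that by (simp add: Q_def)
      moreover have "ratio S \<noteq> eps"
        using that R by (auto simp: Q_def min_ratio_coalitions_iff)
      ultimately show ?thesis
        using eps_le_ratio le_ratio_iff[of S eps] ratio_eq_iff[of S eps] by (auto simp: slack_def)
    qed
    define d where "d = Min (slack ` Q)"
    have Q: "finite Q" "{a} \<in> Q"
      using finite_P singleton_in_P i a_notin by (auto simp: Q_def)
    have d_pos: "d > 0"
      using Q slack unfolding d_def by (subst Min_gr_iff) auto
    have d_le: "d \<le> slack S" if "S \<in> Q" for S
      using Q that by (simp add: d_def)
    \<comment> \<open>Raising user \<open>i\<close> affects only the constraints of coalitions in
      \<open>Q\<close>, and each of them has slack at least \<open>d\<close>.\<close>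
    define y where "y = xs(i := eps + d)"
    have "y \<in> F"
      unfolding feasible_iff
    proof (intro conjI ballI)
      show "y \<in> U \<rightarrow>\<^sub>E UNIV" using i by (auto simp: y_def xs_def)
      show "eps \<le> y j" if "j \<in> U" for j using that d_pos by (auto simp: y_def xs_def)
      fix S assume S: "S \<in> P"
      have fin: "finite (N - S)" using finite_U by simp
      have xsS: "sum xs (N - S) \<le> v N - v S - eps"
        using S xs_feasible by (auto simp: feasible_iff)
      show "sum y (N - S) \<le> v N - v S - eps"
      proof (cases "i \<in> S")
        case True
        then have "sum y (N - S) = sum xs (N - S)"
          by (intro sum.cong) (auto simp: y_def)
        then show ?thesis using xsS by simp
      next
        case False
        have "sum y (N - S) = sum (\<lambda>j. xs j + (if j = i then d else 0)) (N - S)"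
          using i by (intro sum.cong) (auto simp: y_def xs_def)
        also have "\<dots> = sum xs (N - S) + d"
          using fin i False by (simp add: sum.distrib)
        finally show ?thesis
          using d_le[of S] S False sum_xs[OF complement_subset[OF S]]
          by (simp add: Q_def slack_def)
      qed
    qed
    then have "y i = xs i" using F by simp
    then show False using i d_pos by (simp add: y_def xs_def)
  qed
  \<comment> \<open>Some coalition must attain the minimum here, because the intersection of an
    empty family would be the whole type.\<close>
  moreover have "\<Inter> (min_ratio_coalitions U a v) \<subseteq> N"
  proof -
    have "eps \<in> ratio ` P"
      unfolding least_core_value_eq using finite_P singleton_in_P by (intro Min_in) auto
    then obtain S where "S \<in> P" "ratio S = eps" by auto
    then have "S \<in> min_ratio_coalitions U a v" "S \<subseteq> N"
      by (simp_all add: min_ratio_coalitions_iff P_iff psubset_imp_subset)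
    then show ?thesis by blast
  qed
  moreover have "a \<in> \<Inter> (min_ratio_coalitions U a v)"
    by (auto simp: min_ratio_coalitions_iff P_iff)
  ultimately show "\<Inter> (min_ratio_coalitions U a v) = {a}"
    by (intro subset_antisym subsetI) (blast, simp)
qed

end

theorem theorem7:
  fixes U N :: "'p set"
    and a :: 'p
    and n :: "'p \<Rightarrow> nat"
    and D :: "'p \<Rightarrow> ('m::finite) point set"
    and f :: "'p \<Rightarrow> 'm point \<Rightarrow> real"
    and c :: "'p \<Rightarrow> real"
    and fa :: "real ^ 'm \<Rightarrow> real"
    and v :: "'p set \<Rightarrow> real"
    and M_a m_a :: real
    and x_star :: "'p \<Rightarrow> real"
    and S_min :: "'p set"
  assumes game: "energy_sharing_game U a n D f c fa"
    and N: "N = insert a U"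
    and v: "v = energy_sharing_value U a D f c fa"
    and M_a: "M_a = max_share N v a"
    and m_a: "m_a = min_share N v a"
    and x_star: "x_star = (\<lambda>i\<in>U. least_core_value N v)"
    and S_min: "S_min = \<Inter> (min_ratio_coalitions U a v)"
    and core_nonempty: "core N v \<noteq> {}"
  shows "(m_a = M_a \<longleftrightarrow> user_lp_solutions U a v = {x_star}) \<and>
         (user_lp_solutions U a v = {x_star} \<longleftrightarrow> least_core N v = {x_star(a := M_a)}) \<and>
         (least_core N v = {x_star(a := M_a)} \<longleftrightarrow> S_min = {a})"
proof -
  interpret energy_sharing_game U a n D f c fa by (rule game)
  have "v S = 0" if "S \<subseteq> U" for S
    using that aggregator_not_user by (auto simp: v energy_sharing_value_def)
  then interpret veto_game U a v
    using finite_users two_users aggregator_not_user core_nonempty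
    by unfold_locales (auto simp: N)
  have "x_star = xs" by (simp add: x_star xs_def N)
  \<comment> \<open>The share of the aggregator in \<open>extend xs\<close> is
    \<open>v N - sum xs U\<close>, the maximal one.\<close>
  moreover from this have "x_star(a := M_a) = extend xs"
    by (simp add: extend_def M_a N max_share_eq)
  ultimately show ?thesis
    using min_share_eq_max_share_iff user_lp_solutions_iff least_core_singleton_iff
      min_ratio_Inter_iff
    by (simp add: M_a m_a S_min N)
qed

end
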